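(* Let $a,b\in\mathbb{Q}$ with $b\in\mathbb{Q}^2$, suppose that $f(x)=x^8+ax^4+b\in\mathbb{Q}[x]$ is irreducible over $\mathbb{Q}$, and define $$R_1(x)=x^4+(2a+12\sqrt b)x^2+(a-2\sqrt b)^2,\quad R_2(x)=x^4+(2a-12\sqrt b)x^2+(a+2\sqrt b)^2,\quad R_3(x)=x^4-4ax^2+16b.$$ Then, with irreducibility understood over $\mathbb{Q}$: (1) $R_1(x^2)$ is irreducible if and only if $2b+a\sqrt b\notin\mathbb{Q}^2$. If $2b+a\sqrt b\in\mathbb{Q}^2$, then $$R_1(x^2)=\left(x^4+a+6\sqrt b+4\sqrt{2b+a\sqrt b}\right)\left(x^4+a+6\sqrt b-4\sqrt{2b+a\sqrt b}\right).$$ (2) $R_2(x^2)$ is irreducible if and only if $\sqrt b\notin\mathbb{Q}^2$ and $2b-a\sqrt b\notin\mathbb{Q}^2$. (a) If $\sqrt b\in\mathbb{Q}^2$, then $$R_2(x^2)=\left(x^4+4\sqrt{\sqrt b}\,x^2+a+2\sqrt b\right)\left(x^4-4\sqrt{\sqrt b}\,x^2+a+2\sqrt b\right).$$ (b) If $2b-a\sqrt b\in\mathbb{Q}^2$, then $$R_2(x^2)=\left(x^4+a-6\sqrt b+4\sqrt{2b-a\sqrt b}\right)\left(x^4+a-6\sqrt b-4\sqrt{2b-a\sqrt b}\right).$$ (3) $R_3(x^2)$ is irreducible if and only if $a-2\sqrt b\notin\mathbb{Q}^2$ and $a+2\sqrt b\notin\mathbb{Q}^2$. (a) If $a-2\sqrt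 b\in\mathbb{Q}^2$, then $$R_3(x^2)=\left(x^4+2\sqrt{a-2\sqrt b}\,x^2-4\sqrt b\right)\left(x^4-2\sqrt{a-2\sqrt b}\,x^2-4\sqrt b\right).$$ (b) If $a+2\sqrt b\in\mathbb{Q}^2$, then $$R_3(x^2)=\left(x^4+2\sqrt{a+2\sqrt b}\,x^2+4\sqrt b\right)\left(x^4-2\sqrt{a+2\sqrt b}\,x^2+4\sqrt b\right).$$ Moreover, each of the irreducible factors in $R_i(x^2)$ ($1\le i\le 3$) occurs as a factor of $R(x)$ with multiplicity one, where $R(x)$ is the linear resolvent of $f$ corresponding to $x_1+x_2$.
   Context: $\mathbb{Q}^2=\{k^2:k\in\mathbb{Q}\}$, and $\sqrt b$ is the nonnegative square root of $b$ (rational since $b\in\mathbb{Q}^2$). If $\alpha_1,\dots,\alpha_8$ are the roots of $f$ in $\mathbb{C}$, the linear resolvent of $f$ corresponding to $F=x_1+x_2$ is the degree 28 polynomial $R(x)=\prod_{1\le i<j\le 8}\big(x-(\alpha_i+\alpha_j)\big)\in\mathbb{Q}[x]$; one has $R(x)=x^4R_1(x^2)R_2(x^2)R_3(x^2)$. *)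

theory Defs
  imports
    Complex_Main
    "HOL-Computational_Algebra.Computational_Algebra"
    "HOL-Computational_Algebra.Field_as_Ring"
begin

(* Meaningful only for squares of rationals; membership in {k^2 | k rational} is the library's
   is_square at type rat. *)
definition rat_sqrt :: "rat \<Rightarrow> rat" where
  "rat_sqrt q = (THE r. 0 \<le> r \<and> r\<^sup>2 = q)"

lemma rat_sqrt_square: "rat_sqrt (k\<^sup>2) = \<bar>k\<bar>"
  unfolding rat_sqrt_def by (rule the_equality) (auto simp: power2_eq_iff)

lemma of_rat_rat_sqrt:
  assumes "is_square (q :: rat)"
  shows "of_rat (rat_sqrt q) = sqrt (of_rat q)"
proof -
  obtain k where "q = k\<^sup>2"
    using assms by (elim is_nth_powerE)
  then show ?thesis
    by (simp add: rat_sqrt_square of_rat_power abs_if of_rat_minus)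
qed

definition f_poly :: "rat \<Rightarrow> rat \<Rightarrow> rat poly" where
  "f_poly a b = [:b, 0, 0, 0, a, 0, 0, 0, 1:]"

definition R1 :: "rat \<Rightarrow> rat \<Rightarrow> rat poly" where
  "R1 a b = [:(a - 2 * rat_sqrt b)\<^sup>2, 0, 2 * a + 12 * rat_sqrt b, 0, 1:]"

definition R2 :: "rat \<Rightarrow> rat \<Rightarrow> rat poly" where
  "R2 a b = [:(a + 2 * rat_sqrt b)\<^sup>2, 0, 2 * a - 12 * rat_sqrt b, 0, 1:]"

definition R3 :: "rat \<Rightarrow> rat \<Rightarrow> rat poly" where
  "R3 a b = [:16 * b, 0, - 4 * a, 0, 1:]"

definition subst_sq :: "rat poly \<Rightarrow> rat poly" where
  "subst_sq p = pcompose p (monom 1 2)"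

(* The linear resolvent corresponding to x_1 + x_2 of the monic polynomial of degree n with roots
   \<alpha> 1, ..., \<alpha> n (listed with multiplicity), as a polynomial over the complex numbers. *)
definition linear_resolvent :: "nat \<Rightarrow> (nat \<Rightarrow> complex) \<Rightarrow> complex poly" where
  "linear_resolvent n \<alpha> =
     (\<Prod>(i, j) \<in> {(i, j). 1 \<le> i \<and> i < j \<and> j \<le> n}. [:- (\<alpha> i + \<alpha> j), 1:])"

end

theory Submission
  imports Defs
begin

text \<open>
  Write \<open>c = \<surd>b\<close>, so that \<open>b = c\<^sup>2\<close> with \<open>c\<close> rational. All three polynomials
  \<open>R\<^sub>i(x\<^sup>2)\<close>, like \<open>f\<close> itself, are octics \<open>x\<^sup>8 + A x\<^sup>4 + C\<^sup>2\<close> with rational \<open>A\<close> and \<open>C\<close>, and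
  everything rests on two facts about such octics.

  The first is an irreducibility criterion. If \<open>g\<close> is irreducible, monic and of even degree and
  \<open>g(x\<^sup>2)\<close> is reducible, then \<open>g(x\<^sup>2) = p(x) p(-x)\<close> up to a scalar for some \<open>p\<close>. Splitting
  \<open>p = E(x\<^sup>2) + x U(x\<^sup>2)\<close> turns this into \<open>g = E\<^sup>2 - X U\<^sup>2\<close> (\<open>reducible_in_sq_imp_norm\<close>). Applying
  this to \<open>y\<^sup>2 + A y + C\<^sup>2\<close> and then to \<open>y\<^sup>4 + A y\<^sup>2 + C\<^sup>2\<close> and comparing coefficients shows that
  the octic can be reducible only if one of \<open>A\<^sup>2 - 4 C\<^sup>2\<close>, \<open>2 C - A\<close>, \<open>- 2 C - A\<close> is a square, or
  some \<open>t\<close> with \<open>t\<^sup>2 = \<plusminus> C\<close> makes \<open>A + 2 t\<^sup>2\<close> a square (\<open>irreducible_f_poly\<close>). Conversely, a square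
  among the first three expressions gives a visible factorisation. So the irreducibility of \<open>f\<close>
  implies that \<open>a\<^sup>2 - 4 c\<^sup>2\<close>, \<open>2 c - a\<close> and \<open>- 2 c - a\<close> are not squares; in particular \<open>c\<close> is not
  zero and hence positive. For each \<open>R\<^sub>i(x\<^sup>2)\<close> these facts exclude every case of the criterion except
  the ones that the proposition lists.

  The second is that common factors are controlled by resultants of quadratics in \<open>y = x\<^sup>4\<close>. For
  two different \<open>R\<^sub>i\<close> the resultant is a nonzero multiple of a positive definite quadratic form in
  \<open>a\<close> and \<open>c\<close>; comparing an octic with its derivative brings in \<open>C\<close> and the discriminant
  \<open>A\<^sup>2 - 4 C\<^sup>2\<close>, which are nonzero for each \<open>R\<^sub>i(x\<^sup>2)\<close> because \<open>c\<close>, \<open>a - 2 c\<close> and \<open>a + 2 c\<close> are.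
  Hence \<open>R\<^sub>1(x\<^sup>2) R\<^sub>2(x\<^sup>2) R\<^sub>3(x\<^sup>2)\<close> is squarefree and prime to \<open>x\<close>.

  It remains to identify the resolvent. If \<open>\<beta>\<close> is a root of \<open>f\<close> and \<open>\<beta> \<gamma>\<close> is a square root of
  \<open>c\<close>, then \<open>\<gamma>\<^sup>4 = c\<^sup>2 / \<beta>\<^sup>4\<close>, so the roots of \<open>f\<close> are \<open>\<i>\<^sup>k \<beta>\<close> and \<open>\<i>\<^sup>k \<gamma>\<close>. Their 28 pairwise sums
  are \<open>0\<close>, four times, and six orbits under multiplication by \<open>\<i>\<close>, generated by \<open>(1 + \<i>) \<beta>\<close>,
  \<open>(1 + \<i>) \<gamma>\<close>, \<open>\<beta> \<plusminus> \<gamma>\<close> and \<open>\<beta> \<plusminus> \<i> \<gamma>\<close>. An orbit of \<open>z\<close> contributes \<open>x\<^sup>4 - z\<^sup>4\<close>, and pairing the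
  orbits in this order produces \<open>R\<^sub>3(x\<^sup>2)\<close>, \<open>R\<^sub>2(x\<^sup>2)\<close> and \<open>R\<^sub>1(x\<^sup>2)\<close>
  (\<open>linear_resolvent_orbit_roots\<close>).
\<close>

section \<open>Factorisations of polynomials in the square of the variable\<close>

lemma even_odd_parts:
  fixes p :: "'a::comm_ring_1 poly"
  obtains E U where "p = pcompose E (monom 1 2) + [:0, 1:] * pcompose U (monom 1 2)"
proof -
  have "\<exists>E U. p = pcompose E (monom 1 2) + [:0, 1:] * pcompose U (monom 1 2)"
  proof (induction p)
    case 0
    show ?case by (intro exI[of _ 0]) simp
  next
    case (pCons a p)
    then obtain E U where p: "p = pcompose E (monom 1 2) + [:0, 1:] * pcompose U (monom 1 2)"
      by blast
    have "pCons a p = [:a:] + [:0, 1:] * p"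
      by simp
    also have "\<dots> = pcompose (pCons a U) (monom 1 2) + [:0, 1:] * pcompose E (monom 1 2)"
      unfolding p by (simp add: pcompose_pCons algebra_simps monom_altdef power2_eq_square)
    finally show ?case by blast
  qed
  with that show ?thesis by blast
qed

lemma pcompose_sq_eq_iff:
  fixes p q :: "'a::idom poly"
  shows "pcompose p (monom 1 2) = pcompose q (monom 1 2) \<longleftrightarrow> p = q"
proof
  assume "pcompose p (monom 1 2) = pcompose q (monom 1 2)"
  then have "pcompose (p - q) (monom 1 2) = 0"
    by (simp add: pcompose_diff)
  then have "p - q = 0"
    by (rule pcompose_eq_0) (simp add: degree_monom_eq)
  then show "p = q" by simp
qed simp

text \<open>
  The two summands have degrees of different parity, so they cannot cancel.
\<close>

lemma even_odd_parts_eq_0: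
  fixes E U :: "'a::idom poly"
  assumes "pcompose E (monom 1 2) + [:0, 1:] * pcompose U (monom 1 2) = 0"
  shows "E = 0 \<and> U = 0"
proof (rule ccontr)
  assume nz: "\<not> ?thesis"
  have eq: "pcompose E (monom 1 2) = - ([:0, 1:] * pcompose U (monom 1 2))"
    using assms unfolding eq_neg_iff_add_eq_0 .
  have U: "U \<noteq> 0"
  proof
    assume "U = 0"
    then have "pcompose E (monom 1 2) = pcompose 0 (monom 1 2)" using eq by simp
    then show False using nz \<open>U = 0\<close> pcompose_sq_eq_iff by blast
  qed
  then have "pcompose U (monom 1 2) \<noteq> 0"
    using pcompose_sq_eq_iff[of U 0] by simp
  then have "degree ([:0, 1:] * pcompose U (monom 1 2)) = 1 + degree U * 2"
    by (subst degree_mult_eq) (simp_all add: degree_pcompose degree_monom_eq)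
  moreover have "degree (pcompose E (monom 1 2)) = degree E * 2"
    by (simp add: degree_pcompose degree_monom_eq)
  ultimately have "degree E * 2 = 1 + degree U * 2" using eq by (metis degree_minus)
  then show False by presburger
qed

text \<open>
  Substituting \<open>x\<^sup>2\<close> into the polynomial on the left gives \<open>p(x) p(-x)\<close>, where \<open>p\<close> is the polynomial
  on the right. On both sides the parity of the degrees rules out cancellation.
\<close>

lemma degree_even_odd_norm:
  fixes E U :: "'a::idom poly"
  shows "degree (E\<^sup>2 - [:0, 1:] * U\<^sup>2) = degree (pcompose E (monom 1 2) + [:0, 1:] * pcompose U (monom 1 2))"
  (is "degree ?N = degree ?p")
proof (cases "U = 0")
  case True
  then show ?thesis
    by (cases "E = 0") (simp_all add: degree_power_eq degree_pcompose degree_monom_eq degree_mult_eq power2_eq_square)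
next
  case U: False
  then have U2: "pcompose U (monom 1 2) \<noteq> 0"
    using pcompose_sq_eq_iff[of U 0] by simp
  have d1: "degree (- ([:0, 1:] * U\<^sup>2)) = 1 + 2 * degree U" 
    using U by (simp add: degree_power_eq degree_mult_eq)
  have d2: "degree ([:0, 1:] * pcompose U (monom 1 2)) = 1 + 2 * degree U"
    using U2 by (subst degree_mult_eq) (simp_all add: degree_pcompose degree_monom_eq)
  have d3: "degree (E\<^sup>2) = 2 * degree E"
    by (cases "E = 0") (simp_all add: degree_power_eq)
  have d4: "degree (pcompose E (monom 1 2)) = 2 * degree E"
    by (simp add: degree_pcompose degree_monom_eq)
  have "2 * degree E < 1 + 2 * degree U \<or> 2 * degree E > 1 + 2 * degree U" by presburger
  then show ?thesis
  proof
    assume less: "2 * degree E < 1 + 2 * degree U"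
    have "degree (E\<^sup>2 + - ([:0, 1:] * U\<^sup>2)) = 1 + 2 * degree U"
      by (subst degree_add_eq_right) (use less d1 d3 in linarith)+
    moreover have "degree ?p = 1 + 2 * degree U"
      by (subst degree_add_eq_right) (use less d2 d4 in linarith)+
    ultimately show ?thesis by (simp only: diff_conv_add_uminus)
  next
    assume gr: "2 * degree E > 1 + 2 * degree U"
    have "degree (E\<^sup>2 + - ([:0, 1:] * U\<^sup>2)) = 2 * degree E"
      by (subst degree_add_eq_left) (use gr d1 d3 in linarith)+
    moreover have "degree ?p = 2 * degree E"
      by (subst degree_add_eq_left) (use gr d2 d4 in linarith)+
    ultimately show ?thesis by (simp only: diff_conv_add_uminus)
  qed
qed

lemma prod_eq_prime_sq:
  fixes g P Q :: "'a::algebraic_semidom"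
  assumes "prime_elem g" "P * Q = g * g" "\<not> is_unit P" "\<not> is_unit Q"
  shows "\<exists>k. is_unit k \<and> P = k * g"
proof -
  have g0: "g \<noteq> 0" using assms(1) by auto
  have irr: "irreducible g" using assms(1) by (rule prime_elem_imp_irreducible)
  have "g dvd P * Q" using assms(2) by simp
  then consider "g dvd P" | "g dvd Q" using assms(1) prime_elem_dvd_multD by blast
  then show ?thesis
  proof cases
    case 1
    then obtain k where k: "P = g * k" ..
    have "g * (k * Q) = g * g" using assms(2) k by (simp add: mult.assoc)
    then have "g = k * Q" using g0 by simp
    then have "is_unit k" using irreducibleD[OF irr] assms(4) by blast
    then show ?thesis using k by (auto simp: mult.commute)
  next
    case 2
    then obtain k where k: "Q = g * k" ..
    have "g * (k * P) = g * g" using assms(2) k by (simp add: algebra_simps)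
    then have gk: "g = k * P" using g0 by simp
    then have "is_unit k" using irreducibleD[OF irr] assms(3) by blast
    then obtain l where l: "1 = k * l" ..
    then have "P = l * g" using gk by (metis mult.assoc mult.commute mult_1)
    moreover have "is_unit l" using l by (metis dvd_triv_right)
    ultimately show ?thesis by blast
  qed
qed

text \<open>
  A factorisation \<open>g(x\<^sup>2) = p q\<close> is carried to the factorisation \<open>g\<^sup>2 = P Q\<close> of norms, where
  \<open>P(x\<^sup>2) = p(x) p(-x)\<close> and \<open>P = E\<^sup>2 - X U\<^sup>2\<close> for \<open>p = E(x\<^sup>2) + x U(x\<^sup>2)\<close>. Since taking the norm
  preserves degrees, neither \<open>P\<close> nor \<open>Q\<close> is a unit, and as \<open>g\<close> is prime, \<open>P\<close> is a scalar multiple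
  of \<open>g\<close>. The even degree of \<open>g\<close> makes \<open>E\<^sup>2\<close> the leading part of \<open>P\<close>, so the scalar is a square and
  can be absorbed into \<open>E\<close> and \<open>U\<close>.
\<close>

lemma reducible_in_sq_imp_norm:
  fixes g :: "'a::field poly"
  assumes irr: "irreducible g" and "lead_coeff g = 1" and "even (degree g)"
    and red: "\<not> irreducible (pcompose g (monom 1 2))"
  obtains E U where "g = E\<^sup>2 - [:0, 1:] * U\<^sup>2" "2 * degree E = degree g" "2 * degree U < degree g"
proof -
  define \<phi> :: "'a poly \<Rightarrow> 'a poly" where "\<phi> = (\<lambda>p. pcompose p (monom 1 2))"
  note \<phi>_simps = pcompose_add pcompose_diff pcompose_mult
  have g0: "g \<noteq> 0" and degg: "degree g > 0"
    using irr by (auto simp: irreducible_def is_unit_iff_degree)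
  have g20: "\<phi> g \<noteq> 0"
    using g0 pcompose_sq_eq_iff[of g 0] by (simp add: \<phi>_def)
  moreover have "\<not> is_unit (\<phi> g)"
    using degg g20 by (simp add: is_unit_iff_degree \<phi>_def degree_pcompose degree_monom_eq)
  ultimately obtain p q where pq: "\<phi> g = p * q" "\<not> is_unit p" "\<not> is_unit q"
    using red by (auto simp: irreducible_def \<phi>_def)
  obtain E U where p: "p = \<phi> E + [:0, 1:] * \<phi> U"
    unfolding \<phi>_def by (rule even_odd_parts)
  obtain F V where q: "q = \<phi> F + [:0, 1:] * \<phi> V"
    unfolding \<phi>_def by (rule even_odd_parts)
  have X2: "\<phi> [:0, 1:] = [:0, 1:] * [:0, 1:]"
    by (simp add: \<phi>_def pcompose_pCons monom_altdef power2_eq_square)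
  have "\<phi> (E * F + [:0, 1:] * (U * V) - g) + [:0, 1:] * \<phi> (E * V + F * U) = p * q - \<phi> g"
  proof -
    define X :: "'a poly" where "X = [:0, 1:]"
    have "\<phi> X = X * X" using X2 unfolding X_def .
    then have "\<phi> (E * F + X * (U * V) - g) + X * \<phi> (E * V + F * U) = p * q - \<phi> g"
      unfolding p q X_def[symmetric] by (simp add: \<phi>_def \<phi>_simps algebra_simps)
    then show ?thesis unfolding X_def .
  qed
  also have "\<dots> = 0" using pq by simp
  finally have "E * F + [:0, 1:] * (U * V) - g = 0 \<and> E * V + F * U = 0"
    unfolding \<phi>_def by (rule even_odd_parts_eq_0)
  then have gEF: "g = E * F + [:0, 1:] * (U * V)" and cross: "E * V + F * U = 0"
    by auto
  define P where "P = E\<^sup>2 - [:0, 1:] * U\<^sup>2"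
  define Q where "Q = F\<^sup>2 - [:0, 1:] * V\<^sup>2"
  have "P * Q = (E * F + [:0, 1:] * (U * V))\<^sup>2 - [:0, 1:] * (E * V + F * U)\<^sup>2"
    unfolding P_def Q_def by (simp only: power2_eq_square ring_distribs) (simp add: algebra_simps)
  then have PQ: "P * Q = g * g" using gEF cross by (simp add: power2_eq_square)
  have degs: "degree P = degree p" "degree Q = degree q"
    unfolding P_def Q_def p q \<phi>_def by (rule degree_even_odd_norm)+
  have "P \<noteq> 0" "Q \<noteq> 0" using PQ g0 by auto
  moreover have "p \<noteq> 0" "q \<noteq> 0" using pq g20 by auto
  ultimately have "\<not> is_unit P" "\<not> is_unit Q" using degs pq by (simp_all add: is_unit_iff_degree)
  then obtain k where k: "is_unit k" "P = k * g"
    using prod_eq_prime_sq[OF field_poly_irreducible_imp_prime[OF irr] PQ] by blast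
  then obtain \<kappa> where kk: "k = [:\<kappa>:]" "\<kappa> \<noteq> 0"
    unfolding is_unit_poly_iff by (metis dvd_0_left_iff zero_neq_one)
  have Pg: "P = smult \<kappa> g" using k kk by simp
  have degP: "degree P = degree g" using Pg kk by simp
  have d3: "degree (E\<^sup>2) = 2 * degree E"
    by (cases "E = 0") (simp_all add: degree_power_eq)
  have d1: "U \<noteq> 0 \<Longrightarrow> degree ([:0, 1:] * U\<^sup>2) = 1 + 2 * degree U" 
    by (simp add: degree_power_eq degree_mult_eq)
  have lt: "degree ([:0, 1:] * U\<^sup>2) < degree (E\<^sup>2) \<or> U = 0"
  proof (rule ccontr)
    assume "\<not> ?thesis"
    then have U: "U \<noteq> 0" and "degree ([:0, 1:] * U\<^sup>2) \<ge> degree (E\<^sup>2)" by auto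
    then have "degree (- ([:0, 1:] * U\<^sup>2)) > degree (E\<^sup>2)"
      unfolding degree_minus d1[OF U] d3 by presburger
    then have "degree (E\<^sup>2 + - ([:0, 1:] * U\<^sup>2)) = degree ([:0, 1:] * U\<^sup>2)"
      by (subst degree_add_eq_right) simp_all
    then have "degree P = degree ([:0, 1:] * U\<^sup>2)" by (simp only: P_def diff_conv_add_uminus)
    then have "degree g = 1 + 2 * degree U" using degP d1[OF U] by (simp only:)
    then show False using \<open>even (degree g)\<close> by simp
  qed
  have PE: "degree P = degree (E\<^sup>2) \<and> lead_coeff P = lead_coeff (E\<^sup>2)"
  proof (cases "U = 0")
    case True then show ?thesis by (simp add: P_def)
  next
    case False
    then have l: "degree (- ([:0, 1:] * U\<^sup>2)) < degree (E\<^sup>2)" using lt by simp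
    have "P = E\<^sup>2 + - ([:0, 1:] * U\<^sup>2)" by (simp add: P_def)
    then show ?thesis using degree_add_eq_left[OF l] lead_coeff_add_le[of "- ([:0, 1:] * U\<^sup>2)" "E\<^sup>2"] 
      l coeff_eq_0[OF l] by simp
  qed
  have dE: "2 * degree E = degree g"
    using PE degP d3 by simp
  have "lead_coeff P = \<kappa>" using Pg \<open>lead_coeff g = 1\<close> by simp
  then have lE: "(lead_coeff E)\<^sup>2 = \<kappa>"
    using PE by (metis lead_coeff_power)
  have dU: "2 * degree U < degree g"
    using lt d1 d3 dE degg by (cases "U = 0") auto
  define e where "e = lead_coeff E"
  have e: "e \<noteq> 0" "e\<^sup>2 = \<kappa>" using lE kk by (auto simp: e_def)
  have scale: "smult \<kappa> ((smult (inverse e) H)\<^sup>2) = H\<^sup>2" for H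
    using e by (auto simp: smult_power power_inverse)
  have "smult \<kappa> ((smult (inverse e) E)\<^sup>2 - [:0, 1:] * (smult (inverse e) U)\<^sup>2) = P"
    unfolding P_def smult_diff_right mult_smult_right[symmetric] scale ..
  then have "smult \<kappa> ((smult (inverse e) E)\<^sup>2 - [:0, 1:] * (smult (inverse e) U)\<^sup>2) = smult \<kappa> g"
    using Pg by simp
  then have "g = (smult (inverse e) E)\<^sup>2 - [:0, 1:] * (smult (inverse e) U)\<^sup>2"
    using kk smult_cancel[of \<kappa>] by metis
  moreover have "degree (smult (inverse e) E) = degree E" "degree (smult (inverse e) U) = degree U"
    using e by simp_all
  ultimately show ?thesis using that dE dU by metis
qed

section \<open>Irreducibility of even octics\<close>

lemma subst_sq_even_quartic: "subst_sq [:B, 0, A, 0, 1:] = f_poly A B"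
  by (simp add: subst_sq_def f_poly_def pcompose_pCons monom_altdef power2_eq_square)

lemma not_irreducible_mult:
  fixes p q :: "'a::field poly"
  assumes "degree p > 0" "degree q > 0"
  shows "\<not> irreducible (p * q)"
proof
  assume "irreducible (p * q)"
  then have "is_unit p \<or> is_unit q" by (rule irreducibleD) simp
  moreover have "p \<noteq> 0" "q \<noteq> 0" using assms by auto
  ultimately show False using assms by (auto simp: is_unit_iff_degree)
qed

text \<open>
  From a factorisation \<open>(p\<^sub>0 + p\<^sub>1 x)(q\<^sub>0 + q\<^sub>1 x)\<close> the discriminant is read off as
  \<open>(p\<^sub>0 q\<^sub>1 - p\<^sub>1 q\<^sub>0)\<^sup>2\<close>.
\<close>

lemma irreducible_quadratic:
  fixes A B :: rat
  assumes "\<not> is_square (A\<^sup>2 - 4 * B)"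
  shows "irreducible [:B, A, 1:]"
proof (rule irreducibleI)
  fix p q assume pq: "[:B, A, 1:] = p * q"
  show "is_unit p \<or> is_unit q"
  proof (rule ccontr)
    assume "\<not> ?thesis"
    moreover have nz: "p \<noteq> 0" "q \<noteq> 0" using pq by auto
    moreover have "degree p + degree q = 2"
      using arg_cong[OF pq, of degree] nz by (simp add: degree_mult_eq)
    ultimately have "degree p = 1" "degree q = 1"
      by (auto simp: is_unit_iff_degree)
    then obtain p0 p1 q0 q1 where "p = [:p0, p1:]" "q = [:q0, q1:]"
      by (metis degree1_coeffs)
    then have "B = p0 * q0" "A = p0 * q1 + p1 * q0" "p1 * q1 = 1"
      using pq by (auto simp: algebra_simps)
    then have "A\<^sup>2 - 4 * B = (p0 * q1 - p1 * q0)\<^sup>2" by algebra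
    then show False using assms by auto
  qed
qed (auto simp: is_unit_iff_degree)

text \<open>
  A norm form \<open>(e y + z)\<^sup>2 - u\<^sup>2 y\<close> of \<open>y\<^sup>2 + A y + C\<^sup>2\<close> has \<open>z e = \<plusminus> C\<close> and \<open>u\<^sup>2 = 2 z e - A\<close>.
\<close>

lemma irreducible_biquadratic:
  fixes A C :: rat
  assumes "\<not> is_square (A\<^sup>2 - 4 * C\<^sup>2)" "\<not> is_square (2 * C - A)" "\<not> is_square (- 2 * C - A)"
  shows "irreducible [:C\<^sup>2, 0, A, 0, 1:]"
proof (rule ccontr)
  assume red: "\<not> ?thesis"
  have "irreducible [:C\<^sup>2, A, 1:]" using assms(1) by (rule irreducible_quadratic)
  moreover have "pcompose [:C\<^sup>2, A, 1:] (monom 1 2) = [:C\<^sup>2, 0, A, 0, 1:]"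
    by (simp add: pcompose_pCons monom_altdef power2_eq_square)
  ultimately obtain E U where EU: "[:C\<^sup>2, A, 1:] = E\<^sup>2 - [:0, 1:] * U\<^sup>2" 
      "2 * degree E = degree [:C\<^sup>2, A, 1:]" "2 * degree U < degree [:C\<^sup>2, A, 1:]"
    using red reducible_in_sq_imp_norm[of "[:C\<^sup>2, A, 1:]"] by auto
  have "degree E = 1" "degree U = 0" using EU(2,3) by simp_all
  then obtain z e u where "E = [:z, e:]" "U = [:u:]"
    by (metis degree1_coeffs degree_eq_zeroE)
  then have "C\<^sup>2 = z\<^sup>2" "A = 2 * z * e - u\<^sup>2" "e\<^sup>2 = 1"
    using EU(1) by (auto simp: power2_eq_square algebra_simps)
  then have "(z * e = C \<or> z * e = - C)" "u\<^sup>2 = 2 * (z * e) - A"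
    by (auto simp: power2_eq_iff power2_eq_1_iff)
  then have "u\<^sup>2 = 2 * C - A \<or> u\<^sup>2 = - 2 * C - A" by (metis mult_minus_left mult_minus_right)
  then show False using assms(2,3) by (metis is_nth_power_nth_power)
qed

text \<open>
  Here a norm form is \<open>(e y\<^sup>2 + v y + z)\<^sup>2 - y (u y + w)\<^sup>2\<close>. If \<open>u = 0\<close> then \<open>A\<^sup>2 = 4 C\<^sup>2\<close>. Otherwise the
  coefficient equations give, for \<open>t = w / u\<close>, both \<open>t\<^sup>2 = z e = \<plusminus> C\<close> and
  \<open>(v - 2 e t)\<^sup>2 = A + 2 t\<^sup>2\<close>.
\<close>

lemma irreducible_f_poly:
  fixes A C :: rat
  assumes "\<not> is_square (A\<^sup>2 - 4 * C\<^sup>2)" "\<not> is_square (2 * C - A)" "\<not> is_square (- 2 * C - A)"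
    and octic: "\<And>t. t\<^sup>2 = C \<or> t\<^sup>2 = - C \<Longrightarrow> \<not> is_square (A + 2 * t\<^sup>2)"
  shows "irreducible (f_poly A (C\<^sup>2))"
proof (rule ccontr)
  let ?g = "[:C\<^sup>2, 0, A, 0, 1:]"
  assume red: "\<not> ?thesis"
  have "irreducible ?g" using assms(1-3) by (rule irreducible_biquadratic)
  moreover have "pcompose ?g (monom 1 2) = f_poly A (C\<^sup>2)"
    by (simp add: f_poly_def pcompose_pCons monom_altdef power2_eq_square)
  ultimately obtain E U where EU: "?g = E\<^sup>2 - [:0, 1:] * U\<^sup>2" 
      "2 * degree E = degree ?g" "2 * degree U < degree ?g"
    using red reducible_in_sq_imp_norm[of ?g] by auto
  have dE: "degree E = 2" and dU: "degree U \<le> 1" using EU(2,3) by simp_all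
  obtain z v e where E: "E = [:z, v, e:]"
    using degree2_coeffs[OF dE] by metis
  have "U = [:coeff U 0, coeff U 1:]"
    using dU by (intro poly_eqI) (auto simp: coeff_pCons coeff_eq_0 split: nat.split)
  then obtain w u where "U = [:w, u:]" by blast
  with E have *: "C\<^sup>2 = z\<^sup>2" "0 = 2 * z * v - w\<^sup>2" "A = v\<^sup>2 + 2 * z * e - 2 * w * u" "0 = 2 * v * e - u\<^sup>2" "e\<^sup>2 = 1"
    using EU(1) by (auto simp: power2_eq_square algebra_simps)
  show False
  proof (cases "u = 0")
    case True
    then have "v = 0" using * by auto
    then have "A\<^sup>2 - 4 * C\<^sup>2 = 0\<^sup>2" using * True by (simp add: power_mult_distrib)
    then show False using assms(1) by (metis is_nth_power_nth_power)
  next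
    case False
    define t where "t = w / u"
    have w: "w = t * u" using False by (simp add: t_def)
    have v: "v = e * u\<^sup>2 / 2" using *(4,5) by (simp add: power2_eq_square) algebra
    have "u\<^sup>2 * (z * e - t\<^sup>2) = 0" using *(2) v w *(5) by algebra
    then have t: "t\<^sup>2 = z * e" using False by simp
    moreover have "(v - 2 * e * t)\<^sup>2 = A + 2 * t\<^sup>2"
      using *(3,5) v w t by (simp add: power2_eq_square algebra_simps) algebra
    moreover have "z * e = C \<or> z * e = - C" using *(1,5) by (auto simp: power2_eq_iff power2_eq_1_iff)
    ultimately show False using octic by (metis is_nth_power_nth_power)
  qed
qed

lemma f_poly_binomial_factors:
  assumes "A = 2 * u" "B = u\<^sup>2 - v\<^sup>2"
  shows "f_poly A B = [:u + v, 0, 0, 0, 1:] * [:u - v, 0, 0, 0, 1:]"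
  using assms by (simp add: f_poly_def power2_eq_square algebra_simps)

lemma f_poly_conjugate_factors:
  assumes "d\<^sup>2 = 2 * C - A" "B = C\<^sup>2"
  shows "f_poly A B = [:C, 0, d, 0, 1:] * [:C, 0, - d, 0, 1:]"
proof -
  have "A = 2 * C - d\<^sup>2" using assms by simp
  then show ?thesis using assms(2) by (simp add: f_poly_def power2_eq_square)
qed

text \<open>
  Each of the three squares would yield one of the two factorisations above.
\<close>

lemma irreducible_f_polyD:
  assumes irr: "irreducible (f_poly A (C\<^sup>2))"
  shows "\<not> is_square (A\<^sup>2 - 4 * C\<^sup>2)" "\<not> is_square (2 * C - A)" "\<not> is_square (- 2 * C - A)"
proof -
  show "\<not> is_square (A\<^sup>2 - 4 * C\<^sup>2)"
  proof
    assume "is_square (A\<^sup>2 - 4 * C\<^sup>2)"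
    then obtain d where "A\<^sup>2 - 4 * C\<^sup>2 = d\<^sup>2" by (elim is_nth_powerE)
    then have "C\<^sup>2 = (A / 2)\<^sup>2 - (d / 2)\<^sup>2"
      unfolding power_divide by simp
    then have "f_poly A (C\<^sup>2) = [:A / 2 + d / 2, 0, 0, 0, 1:] * [:A / 2 - d / 2, 0, 0, 0, 1:]"
      by (intro f_poly_binomial_factors) simp_all
    then show False
      using irr not_irreducible_mult[of "[:A / 2 + d / 2, 0, 0, 0, 1:]" "[:A / 2 - d / 2, 0, 0, 0, 1:]"] by simp
  qed
  have "\<not> is_square (2 * C' - A)" if "C' \<in> {C, - C}" for C'
  proof
    assume "is_square (2 * C' - A)"
    then obtain d where "2 * C' - A = d\<^sup>2" by (elim is_nth_powerE)
    then have "f_poly A (C\<^sup>2) = [:C', 0, d, 0, 1:] * [:C', 0, - d, 0, 1:]"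
      using that by (intro f_poly_conjugate_factors) auto
    then show False
      using irr not_irreducible_mult[of "[:C', 0, d, 0, 1:]" "[:C', 0, - d, 0, 1:]"] by simp
  qed
  from this[of C] this[of "- C"]
  show "\<not> is_square (2 * C - A)" "\<not> is_square (- 2 * C - A)" by simp_all
qed

section \<open>Irreducibility of the factors of the resolvent\<close>

lemma rat_sqrt_nonneg_power2:
  assumes "is_square q"
  shows "0 \<le> rat_sqrt q" "(rat_sqrt q)\<^sup>2 = q"
proof -
  obtain k where "q = k\<^sup>2" using assms by (elim is_nth_powerE)
  then show "0 \<le> rat_sqrt q" "(rat_sqrt q)\<^sup>2 = q" by (simp_all add: rat_sqrt_square)
qed

lemma is_square_mult_power2D:
  fixes x m :: rat
  assumes "is_square y" "y = m\<^sup>2 * x" "m \<noteq> 0"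
  shows "is_square x"
proof -
  obtain k where "y = k\<^sup>2" using assms(1) by (elim is_nth_powerE)
  then have "x = (k / m)\<^sup>2" using assms by (simp add: power_divide field_simps)
  then show ?thesis by simp
qed

lemma is_square_rat_nonneg: "is_square (x :: rat) \<Longrightarrow> 0 \<le> x"
  by (elim is_nth_powerE) simp

text \<open>
  Taking \<open>e = c\<close> gives \<open>R\<^sub>1(x\<^sup>2)\<close> and \<open>e = - c\<close> gives \<open>R\<^sub>2(x\<^sup>2)\<close>. The last case of the criterion cannot
  occur: there \<open>a - 2 e\<close> and \<open>4 (a + 2 e)\<close> would both be squares, and hence so would
  \<open>a\<^sup>2 - 4 e\<^sup>2\<close>.
\<close>

lemma irreducible_resolvent_factor:
  fixes a e :: rat
  assumes disc: "\<not> is_square (a\<^sup>2 - 4 * e\<^sup>2)"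
    and neg: "\<not> is_square (2 * e - a)" "\<not> is_square (- 2 * e - a)"
    and "\<not> is_square (- e)" "\<not> is_square (2 * e\<^sup>2 + a * e)"
  shows "irreducible (f_poly (2 * a + 12 * e) ((a - 2 * e)\<^sup>2))"
proof (rule irreducible_f_poly)
  have "(2 * a + 12 * e)\<^sup>2 - 4 * (a - 2 * e)\<^sup>2 = 8\<^sup>2 * (2 * e\<^sup>2 + a * e)" by algebra
  then show "\<not> is_square ((2 * a + 12 * e)\<^sup>2 - 4 * (a - 2 * e)\<^sup>2)"
    using assms(5) is_square_mult_power2D[of _ 8] by auto
  have "2 * (a - 2 * e) - (2 * a + 12 * e) = 4\<^sup>2 * (- e)" by simp
  then show "\<not> is_square (2 * (a - 2 * e) - (2 * a + 12 * e))"
    using assms(4) is_square_mult_power2D[of _ 4] by fastforce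
  have "- 2 * (a - 2 * e) - (2 * a + 12 * e) = 2\<^sup>2 * (- 2 * e - a)" by simp
  then show "\<not> is_square (- 2 * (a - 2 * e) - (2 * a + 12 * e))"
    using neg(2) is_square_mult_power2D[of _ 2] by fastforce
  fix t assume t: "t\<^sup>2 = a - 2 * e \<or> t\<^sup>2 = - (a - 2 * e)"
  have t2: "t\<^sup>2 = a - 2 * e"
  proof (rule ccontr)
    assume "t\<^sup>2 \<noteq> a - 2 * e"
    then have "2 * e - a = t\<^sup>2" using t by simp
    then show False using neg(1) by simp
  qed
  show "\<not> is_square (2 * a + 12 * e + 2 * t\<^sup>2)"
  proof
    assume "is_square (2 * a + 12 * e + 2 * t\<^sup>2)"
    then obtain s where s: "2 * a + 12 * e + 2 * t\<^sup>2 = s\<^sup>2" by (elim is_nth_powerE)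
    then have "(s * t)\<^sup>2 = 2\<^sup>2 * (a\<^sup>2 - 4 * e\<^sup>2)" using t2 by algebra
    from is_square_mult_power2D[OF _ this] show False using disc by simp
  qed
qed

text \<open>
  Since \<open>R\<^sub>3(x\<^sup>2) = 16 f(x / (1 + \<i>))\<close>, the hypotheses mirror those for \<open>f\<close>, with the sign of \<open>a\<close>
  reversed. In the last case of the criterion \<open>t\<^sup>2 = 4 c\<close>, which would make \<open>2 c - a\<close> a square.
\<close>

lemma irreducible_resolvent_factor_R3:
  fixes a c :: rat
  assumes "c > 0" and disc: "\<not> is_square (a\<^sup>2 - 4 * c\<^sup>2)" and neg: "\<not> is_square (2 * c - a)"
    and "\<not> is_square (a - 2 * c)" "\<not> is_square (a + 2 * c)"
  shows "irreducible (f_poly (- 4 * a) ((4 * c)\<^sup>2))"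
proof (rule irreducible_f_poly)
  have "(- 4 * a)\<^sup>2 - 4 * (4 * c)\<^sup>2 = 4\<^sup>2 * (a\<^sup>2 - 4 * c\<^sup>2)" by algebra
  then show "\<not> is_square ((- 4 * a)\<^sup>2 - 4 * (4 * c)\<^sup>2)"
    using disc is_square_mult_power2D[of _ 4] by fastforce
  have "2 * (4 * c) - (- 4 * a) = 2\<^sup>2 * (a + 2 * c)" by simp
  then show "\<not> is_square (2 * (4 * c) - (- 4 * a))"
    using assms(5) is_square_mult_power2D[of _ 2] by fastforce
  have "- 2 * (4 * c) - (- 4 * a) = 2\<^sup>2 * (a - 2 * c)" by simp
  then show "\<not> is_square (- 2 * (4 * c) - (- 4 * a))"
    using assms(4) is_square_mult_power2D[of _ 2] by fastforce
  fix t assume t: "t\<^sup>2 = 4 * c \<or> t\<^sup>2 = - (4 * c)"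
  have "t\<^sup>2 \<noteq> - (4 * c)" using \<open>c > 0\<close> zero_le_power2[of t] by linarith
  then have "- 4 * a + 2 * t\<^sup>2 = 2\<^sup>2 * (2 * c - a)" using t by simp
  then show "\<not> is_square (- 4 * a + 2 * t\<^sup>2)"
    using neg is_square_mult_power2D[of _ 2] by fastforce
qed

section \<open>Common and repeated factors\<close>

lemma f_poly_nonzero [simp]: "f_poly A B \<noteq> 0"
  by (simp add: f_poly_def)

text \<open>
  The nonzero number is the resultant of \<open>y\<^sup>2 + A y + B\<close> and \<open>y\<^sup>2 + A' y + B'\<close>; it is a combination of
  these two polynomials, and so of the octics after substituting \<open>y = x\<^sup>4\<close>.
\<close>

lemma f_poly_coprime:
  fixes p :: "rat poly"
  assumes "p dvd f_poly A B" "p dvd f_poly A' B'"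
    and "(B - B')\<^sup>2 - A * (A - A') * (B - B') + (A - A')\<^sup>2 * B \<noteq> 0"
  shows "is_unit p"
proof -
  let ?d = "A - A'" and ?e = "B - B'"
  \<comment> \<open>\<open>d y + e\<close> is the difference of the quadratics; dividing \<open>d\<^sup>2 (y\<^sup>2 + A y + B)\<close> by it leaves the resultant\<close>
  have "p dvd smult (?d\<^sup>2) (f_poly A B) -
      [:A * ?d - ?e, 0, 0, 0, ?d:] * (f_poly A B - f_poly A' B')"
    using assms(1,2) by (intro dvd_diff dvd_smult dvd_mult)
  also have "\<dots> = [:?e\<^sup>2 - A * ?d * ?e + ?d\<^sup>2 * B:]"
    by (simp add: f_poly_def power2_eq_square algebra_simps)
  finally show ?thesis
    using assms(3) by (metis is_unit_const_poly_iff dvd_field_iff dvd_trans)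
qed

lemma prime_factor_f_poly_not_dvd_X_power:
  fixes p :: "rat poly"
  assumes p: "prime_elem p" and "p dvd f_poly A B" "B \<noteq> 0"
  shows "\<not> p dvd [:0, 1:] ^ n"
proof
  assume "p dvd [:0, 1:] ^ n"
  then have "p dvd [:0, 1:]" using p prime_elem_dvd_power by blast
  then have "p dvd f_poly A B - [:0, 1:] * [:0, 0, 0, A, 0, 0, 0, 1:]"
    using assms(2) by (intro dvd_diff dvd_mult2)
  also have "\<dots> = [:B:]" by (simp add: f_poly_def)
  finally have "is_unit p" using \<open>B \<noteq> 0\<close> by (metis is_unit_const_poly_iff dvd_field_iff dvd_trans)
  then show False using p by (simp add: prime_elem_def)
qed

text \<open>
  A repeated prime factor \<open>p\<close> also divides the derivative \<open>4 x\<^sup>3 (2 x\<^sup>4 + A)\<close>. As \<open>p\<close> does not divide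
  \<open>x\<close>, it divides \<open>2 x\<^sup>4 + A\<close>, and modulo this factor four times the octic is \<open>4 B - A\<^sup>2\<close>.
\<close>

lemma f_poly_squarefree:
  fixes p :: "rat poly"
  assumes p: "prime_elem p" and "p * p dvd f_poly A B" and "B \<noteq> 0" "A\<^sup>2 - 4 * B \<noteq> 0"
  shows False
proof -
  obtain k where k: "f_poly A B = p * p * k" using assms(2) ..
  have "pderiv (f_poly A B) = p * (pderiv p * k + pderiv p * k + p * pderiv k)"
    unfolding k by (simp add: pderiv_mult algebra_simps)
  moreover have "pderiv (f_poly A B) = smult 4 ([:0, 1:] ^ 3 * [:A, 0, 0, 0, 2:])"
    by (simp add: f_poly_def pderiv_pCons power3_eq_cube)
  ultimately have "p dvd smult 4 ([:0, 1:] ^ 3 * [:A, 0, 0, 0, 2:])" by (metis dvd_triv_left)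
  then have "p dvd [:0, 1:] ^ 3 * [:A, 0, 0, 0, 2:]" by (simp add: dvd_smult_iff)
  then have "p dvd [:0, 1:] ^ 3 \<or> p dvd [:A, 0, 0, 0, 2:]"
    using p prime_elem_dvd_multD by blast
  moreover have pf: "p dvd f_poly A B" using k by simp
  ultimately have "p dvd [:A, 0, 0, 0, 2:]"
    using prime_factor_f_poly_not_dvd_X_power[OF p] \<open>B \<noteq> 0\<close> by blast
  then have "p dvd smult 4 (f_poly A B) - [:A, 0, 0, 0, 2:] * [:A, 0, 0, 0, 2:]"
    using pf by (intro dvd_diff dvd_smult dvd_mult2)
  also have "\<dots> = [:4 * B - A\<^sup>2:]"
    by (simp add: f_poly_def power2_eq_square)
  finally have "is_unit p"
    using \<open>A\<^sup>2 - 4 * B \<noteq> 0\<close> by (metis is_unit_const_poly_iff dvd_field_iff dvd_trans eq_iff_diff_eq_0)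
  then show False using p by (simp add: prime_elem_def)
qed

lemma multiplicity_f_poly_eq_1:
  fixes p :: "rat poly"
  assumes "prime_elem p" "p dvd f_poly A B" and "B \<noteq> 0" "A\<^sup>2 - 4 * B \<noteq> 0"
  shows "multiplicity p (f_poly A B) = 1"
proof (rule multiplicity_eqI)
  show "p ^ 1 dvd f_poly A B" using assms by simp
  show "\<not> p ^ Suc 1 dvd f_poly A B"
    using f_poly_squarefree[OF assms(1) _ assms(3,4)] by auto
qed

lemma multiplicity_eq_1_last_factor:
  fixes p :: "rat poly"
  assumes p: "prime_elem p" and "S \<noteq> 0" "T \<noteq> 0" "U \<noteq> 0" "V \<noteq> 0"
   "\<not> p dvd S" "\<not> p dvd T" "\<not> p dvd U" "multiplicity p V = 1"
  shows "multiplicity p (S * T * U * V) = 1"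
  using assms by (simp add: prime_elem_multiplicity_mult_distrib not_dvd_imp_multiplicity_0)

text \<open>
  The resultant is a multiple of the positive definite form \<open>4 a\<^sup>2 + 9 c\<^sup>2\<close>.
\<close>

lemma coprime_R1_R2:
  fixes p :: "rat poly"
  assumes "p dvd f_poly (2 * a + 12 * c) ((a - 2 * c)\<^sup>2)" "p dvd f_poly (2 * a - 12 * c) ((a + 2 * c)\<^sup>2)"
    and "c \<noteq> 0"
  shows "is_unit p"
proof (rule f_poly_coprime[OF assms(1,2)])
  have "((a - 2 * c)\<^sup>2 - (a + 2 * c)\<^sup>2)\<^sup>2
      - (2 * a + 12 * c) * ((2 * a + 12 * c) - (2 * a - 12 * c)) * ((a - 2 * c)\<^sup>2 - (a + 2 * c)\<^sup>2)
      + ((2 * a + 12 * c) - (2 * a - 12 * c))\<^sup>2 * (a - 2 * c)\<^sup>2 = 256 * c\<^sup>2 * (4 * a\<^sup>2 + 9 * c\<^sup>2)"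
    by algebra
  also have "\<dots> \<noteq> 0"
    using \<open>c \<noteq> 0\<close> by (simp add: add_nonneg_eq_0_iff)
  finally show "((a - 2 * c)\<^sup>2 - (a + 2 * c)\<^sup>2)\<^sup>2
      - (2 * a + 12 * c) * ((2 * a + 12 * c) - (2 * a - 12 * c)) * ((a - 2 * c)\<^sup>2 - (a + 2 * c)\<^sup>2)
      + ((2 * a + 12 * c) - (2 * a - 12 * c))\<^sup>2 * (a - 2 * c)\<^sup>2 \<noteq> 0" .
qed

text \<open>
  The resultant is \<open>(a + 2 e)\<^sup>2 (25 a\<^sup>2 - 156 a e + 612 e\<^sup>2)\<close>; multiplying by 25 completes the square
  without fractions. Taking \<open>e = - c\<close> compares \<open>R\<^sub>2\<close> with \<open>R\<^sub>3\<close>.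
\<close>

lemma coprime_R1_R3:
  fixes p :: "rat poly"
  assumes "p dvd f_poly (2 * a + 12 * e) ((a - 2 * e)\<^sup>2)" "p dvd f_poly (- 4 * a) (16 * e\<^sup>2)"
    and "e \<noteq> 0" "a + 2 * e \<noteq> 0"
  shows "is_unit p"
proof (rule f_poly_coprime[OF assms(1,2)])
  have "25 * (((a - 2 * e)\<^sup>2 - 16 * e\<^sup>2)\<^sup>2
      - (2 * a + 12 * e) * ((2 * a + 12 * e) - (- 4 * a)) * ((a - 2 * e)\<^sup>2 - 16 * e\<^sup>2)
      + ((2 * a + 12 * e) - (- 4 * a))\<^sup>2 * (a - 2 * e)\<^sup>2) =
      (a + 2 * e)\<^sup>2 * ((25 * a - 78 * e)\<^sup>2 + 9216 * e\<^sup>2)"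
    by algebra
  moreover have "(a + 2 * e)\<^sup>2 * ((25 * a - 78 * e)\<^sup>2 + 9216 * e\<^sup>2) \<noteq> 0"
    using assms(3,4) by (simp add: add_nonneg_eq_0_iff)
  ultimately show "((a - 2 * e)\<^sup>2 - 16 * e\<^sup>2)\<^sup>2
      - (2 * a + 12 * e) * ((2 * a + 12 * e) - (- 4 * a)) * ((a - 2 * e)\<^sup>2 - 16 * e\<^sup>2)
      + ((2 * a + 12 * e) - (- 4 * a))\<^sup>2 * (a - 2 * e)\<^sup>2 \<noteq> 0"
    by (metis mult_zero_right)
qed

section \<open>The linear resolvent\<close>

lemma proots_prod_linear_factors:
  fixes \<alpha> :: "'b \<Rightarrow> 'a::idom"
  assumes "finite A"
  shows "proots (\<Prod>i\<in>A. [:- \<alpha> i, 1:]) = image_mset \<alpha> (mset_set A)"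
  using assms
proof induction
  case (insert x F)
  have "proots (\<Prod>i\<in>insert x F. [:- \<alpha> i, 1:]) = proots ([:- \<alpha> x, 1:] * (\<Prod>i\<in>F. [:- \<alpha> i, 1:]))"
    using insert.hyps by simp
  also have "\<dots> = proots [:- \<alpha> x, 1:] + proots (\<Prod>i\<in>F. [:- \<alpha> i, 1:])"
    by (rule proots_mult) (use insert.hyps in \<open>auto simp del: mult_pCons_left\<close>)
  finally show ?case using insert by simp
qed simp

text \<open>
  Over all ordered pairs \<open>(i, j)\<close> the product is indexed symmetrically in the roots, unlike the
  resolvent, whose index set depends on the numbering. Each unordered pair is counted twice.
\<close>

lemma linear_resolvent_squared:
  "(linear_resolvent n \<alpha>)\<^sup>2 * (\<Prod>i = 1..n. [:- (\<alpha> i + \<alpha> i), 1:]) =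
     (\<Prod>i = 1..n. \<Prod>j = 1..n. [:- (\<alpha> i + \<alpha> j), 1:])"
proof -
  define P :: "(nat \<times> nat) set" where "P = {(i, j). 1 \<le> i \<and> i < j \<and> j \<le> n}"
  define D :: "(nat \<times> nat) set" where "D = (\<lambda>i. (i, i)) ` {1..n}"
  let ?h = "\<lambda>(i, j). [:- (\<alpha> i + \<alpha> j), 1:]"
  have square: "{1..n} \<times> {1..n} = P \<union> prod.swap ` P \<union> D"
    by (auto simp: P_def D_def image_iff)
  have fin: "finite P" "finite D"
    by (auto simp: D_def P_def intro: finite_subset[of _ "{1..n} \<times> {1..n}"])
  have swap: "prod ?h (prod.swap ` P) = prod ?h P"
    by (subst prod.reindex) (auto intro!: prod.cong simp: add.commute)
  have diag: "prod ?h D = (\<Prod>i = 1..n. [:- (\<alpha> i + \<alpha> i), 1:])"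
    unfolding D_def by (subst prod.reindex) (auto simp: inj_on_def)
  have "(\<Prod>i = 1..n. \<Prod>j = 1..n. [:- (\<alpha> i + \<alpha> j), 1:]) = prod ?h (P \<union> prod.swap ` P \<union> D)"
    unfolding square[symmetric] by (rule prod.cartesian_product)
  also have "\<dots> = prod ?h P * prod ?h (prod.swap ` P) * prod ?h D"
    using fin by (subst prod.union_disjoint; (subst prod.union_disjoint)?) (auto simp: P_def D_def)
  finally show ?thesis
    unfolding swap diag by (simp add: linear_resolvent_def P_def power2_eq_square)
qed

lemma linear_resolvent_monic: "lead_coeff (linear_resolvent n \<alpha>) = 1"
  unfolding linear_resolvent_def by (subst lead_coeff_prod) (auto intro!: prod.neutral)

text \<open>
  The resolvent does not depend on the numbering of the roots: the product over ordered pairs is a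
  function of the multiset of roots, so the squares of the two resolvents agree, and the sign is
  fixed because both are monic.
\<close>

lemma linear_resolvent_cong:
  assumes eq: "(\<Prod>i = 1..n. [:- \<alpha> i, 1:]) = (\<Prod>i = 1..n. [:- \<delta> i, 1:])"
  shows "linear_resolvent n \<alpha> = linear_resolvent n \<delta>"
proof -
  have roots: "image_mset \<alpha> (mset_set {1..n}) = image_mset \<delta> (mset_set {1..n})"
    using arg_cong[OF eq, of proots] by (simp only: proots_prod_linear_factors finite_atLeastAtMost)
  have symmetric: "(\<Prod>i = 1..n. H (\<alpha> i)) = (\<Prod>i = 1..n. H (\<delta> i))" for H :: "complex \<Rightarrow> complex poly"
    using arg_cong[OF roots, of "\<lambda>M. prod_mset (image_mset H M)"]
    by (simp add: multiset.map_comp prod_unfold_prod_mset comp_def)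
  have shift: "(\<Prod>j = 1..n. [:- (x + \<delta> j), 1:]) = (\<Prod>j = 1..n. [:- (x + \<alpha> j), 1:])" for x
    using symmetric[of "\<lambda>y. [:- (x + y), 1:]"] by simp
  have "(\<Prod>i = 1..n. \<Prod>j = 1..n. [:- (\<alpha> i + \<alpha> j), 1:]) = (\<Prod>i = 1..n. \<Prod>j = 1..n. [:- (\<delta> i + \<delta> j), 1:])"
    unfolding shift by (rule symmetric)
  then have "(linear_resolvent n \<alpha>)\<^sup>2 * (\<Prod>i = 1..n. [:- (\<alpha> i + \<alpha> i), 1:]) =
      (linear_resolvent n \<delta>)\<^sup>2 * (\<Prod>i = 1..n. [:- (\<delta> i + \<delta> i), 1:])"
    by (simp only: linear_resolvent_squared)
  moreover have diag: "(\<Prod>i = 1..n. [:- (\<alpha> i + \<alpha> i), 1:]) = (\<Prod>i = 1..n. [:- (\<delta> i + \<delta> i), 1:])"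
    by (rule symmetric)
  moreover have nz: "(\<Prod>i = 1..n. [:- (\<delta> i + \<delta> i), 1:]) \<noteq> 0"
    by simp
  ultimately have "(linear_resolvent n \<alpha>)\<^sup>2 = (linear_resolvent n \<delta>)\<^sup>2"
    unfolding diag mult_right_cancel[OF nz] by blast
  then consider "linear_resolvent n \<alpha> = linear_resolvent n \<delta>" | "linear_resolvent n \<alpha> = - linear_resolvent n \<delta>"
    by (auto simp: power2_eq_iff)
  then show ?thesis
  proof cases
    case 2
    then have "lead_coeff (linear_resolvent n \<alpha>) = - lead_coeff (linear_resolvent n \<delta>)"
      by (simp add: lead_coeff_minus)
    then have "(1 :: complex) = - 1" by (simp only: linear_resolvent_monic)
    then show ?thesis by simp
  qed
qed

lemma prod_linear_factors_imaginary_orbit: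
  "[:- z, 1:] * [:- (- z), 1:] * [:- (\<i> * z), 1:] * [:- (- \<i> * z), 1:] = [:- (z ^ 4), 0, 0, 0, 1:]"
  by (simp add: algebra_simps power4_eq_xxxx)

text \<open>
  The numbering starts at 1 because the resolvent is indexed by \<open>1, \<dots>, n\<close>.
\<close>

definition orbit_roots :: "complex \<Rightarrow> complex \<Rightarrow> nat \<Rightarrow> complex" where
  "orbit_roots \<beta> \<gamma> i = [\<beta>, - \<beta>, \<i> * \<beta>, - \<i> * \<beta>, \<gamma>, - \<gamma>, \<i> * \<gamma>, - \<i> * \<gamma>] ! (i - 1)"

lemma prod_orbit_roots:
  assumes "\<beta> ^ 4 + \<gamma> ^ 4 = - A" "(\<beta> * \<gamma>)\<^sup>2 = C"
  shows "(\<Prod>i = 1..8. [:- orbit_roots \<beta> \<gamma> i, 1:]) = [:C\<^sup>2, 0, 0, 0, A, 0, 0, 0, 1:]"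
proof -
  define L where "L z = [:- z, 1:]" for z :: complex
  have "(\<Prod>i = 1..8. L (orbit_roots \<beta> \<gamma> i)) = prod_list (map (\<lambda>i. L (orbit_roots \<beta> \<gamma> i)) [1..<9])"
    by (subst prod.distinct_set_conv_list[symmetric]) (auto intro!: prod.cong)
  also have "\<dots> = (L \<beta> * L (- \<beta>) * L (\<i> * \<beta>) * L (- \<i> * \<beta>)) * (L \<gamma> * L (- \<gamma>) * L (\<i> * \<gamma>) * L (- \<i> * \<gamma>))"
    by (simp add: upt_rec orbit_roots_def mult.assoc)
  also have "\<dots> = [:- (\<beta> ^ 4), 0, 0, 0, 1:] * [:- (\<gamma> ^ 4), 0, 0, 0, 1:]"
    unfolding L_def prod_linear_factors_imaginary_orbit ..
  also have "\<dots> = [:((\<beta> * \<gamma>)\<^sup>2)\<^sup>2, 0, 0, 0, - (\<beta> ^ 4 + \<gamma> ^ 4), 0, 0, 0, 1:]"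
    by (simp add: algebra_simps)
  finally show ?thesis using assms by (simp add: L_def)
qed

text \<open>
  The product of the two constant terms is \<open>(\<beta>\<^sup>2 - \<gamma>\<^sup>2)\<^sup>4\<close>, and both coefficients are polynomials in
  \<open>\<beta>\<^sup>4 + \<gamma>\<^sup>4\<close> and \<open>(\<beta> \<gamma>)\<^sup>2\<close>. Replacing \<open>\<gamma>\<close> by \<open>\<i> \<gamma>\<close> keeps \<open>A\<close> and changes the sign of \<open>C\<close>, which is
  how \<open>R\<^sub>1\<close> arises from the computation for \<open>R\<^sub>2\<close>.
\<close>

lemma quartic_orbit_pair:
  fixes \<beta> \<gamma> :: "'a::idom"
  assumes sum: "\<beta> ^ 4 + \<gamma> ^ 4 = - A" and prd: "(\<beta> * \<gamma>)\<^sup>2 = C"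
  shows "[:- ((\<beta> + \<gamma>) ^ 4), 0, 0, 0, 1:] * [:- ((\<beta> - \<gamma>) ^ 4), 0, 0, 0, 1:] =
    [:(A + 2 * C)\<^sup>2, 0, 0, 0, 2 * A - 12 * C, 0, 0, 0, 1:]"
proof -
  have "(\<beta> + \<gamma>) ^ 4 * (\<beta> - \<gamma>) ^ 4 = ((\<beta> ^ 4 + \<gamma> ^ 4) - 2 * (\<beta> * \<gamma>)\<^sup>2)\<^sup>2"
    by algebra
  also have "\<dots> = (A + 2 * C)\<^sup>2"
    unfolding sum prd by algebra
  finally have prod4: "(\<beta> + \<gamma>) ^ 4 * (\<beta> - \<gamma>) ^ 4 = (A + 2 * C)\<^sup>2" .
  have "- ((\<beta> + \<gamma>) ^ 4) + - ((\<beta> - \<gamma>) ^ 4) = - 2 * (\<beta> ^ 4 + \<gamma> ^ 4) - 12 * (\<beta> * \<gamma>)\<^sup>2"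
    by algebra
  also have "\<dots> = 2 * A - 12 * C"
    unfolding sum prd by simp
  finally have sum4: "- ((\<beta> + \<gamma>) ^ 4) + - ((\<beta> - \<gamma>) ^ 4) = 2 * A - 12 * C" .
  have "[:- x, 0, 0, 0, 1:] * [:- y, 0, 0, 0, 1:] = [:x * y, 0, 0, 0, - x + - y, 0, 0, 0, 1:]" for x y :: 'a
    by simp
  then show ?thesis unfolding prod4[symmetric] sum4[symmetric] .
qed

text \<open>
  Multiplication by \<open>\<i>\<close> permutes the roots and hence their pairwise sums. Besides four zero sums there
  are six orbits \<open>z, - z, \<i> z, - \<i> z\<close>; in the proof each of them becomes one factor \<open>O4 z\<close>, and the orbits
  are then combined in pairs.
\<close>

lemma linear_resolvent_orbit_roots:
  assumes sum: "\<beta> ^ 4 + \<gamma> ^ 4 = - A" and prd: "(\<beta> * \<gamma>)\<^sup>2 = C"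
  shows "linear_resolvent 8 (orbit_roots \<beta> \<gamma>) =
    [:0, 1:] ^ 4 * [:(A - 2 * C)\<^sup>2, 0, 0, 0, 2 * A + 12 * C, 0, 0, 0, 1:]
      * [:(A + 2 * C)\<^sup>2, 0, 0, 0, 2 * A - 12 * C, 0, 0, 0, 1:]
      * [:16 * C\<^sup>2, 0, 0, 0, - 4 * A, 0, 0, 0, 1:]"
proof -
  define L where "L z = [:- z, 1:]" for z :: complex
  define O4 where "O4 z = [:- (z ^ 4), 0, 0, 0, 1:]" for z :: complex
  let ?l = "concat (map (\<lambda>i. map (Pair i) [Suc i..<9]) [1..<9])"
  have set: "{(i, j). 1 \<le> i \<and> i < j \<and> j \<le> 8} = set ?l"
    by (force simp: image_iff)
  have dist: "distinct ?l"
    by (simp add: upt_rec)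
  have orbit: "L u * L u' * L v * L v' = O4 z" if "u = z" "u' = - z" "v = \<i> * z" "v' = - \<i> * z" for u u' v v' z
    using prod_linear_factors_imaginary_orbit[of z] that by (simp only: L_def O4_def)
  have g0: "L (\<beta> + - \<beta>) * L (\<i> * \<beta> + - \<i> * \<beta>) * L (\<gamma> + - \<gamma>) * L (\<i> * \<gamma> + - \<i> * \<gamma>) = [:0, 1:] ^ 4"
    by (simp add: L_def power4_eq_xxxx)
  have g1: "L (\<beta> + \<i> * \<beta>) * L (- \<beta> + - \<i> * \<beta>) * L (- \<beta> + \<i> * \<beta>) * L (\<beta> + - \<i> * \<beta>) = O4 ((1 + \<i>) * \<beta>)"
    by (rule orbit) (simp_all add: algebra_simps)
  have g2: "L (\<gamma> + \<i> * \<gamma>) * L (- \<gamma> + - \<i> * \<gamma>) * L (- \<gamma> + \<i> * \<gamma>) * L (\<gamma> + - \<i> * \<gamma>) = O4 ((1 + \<i>) * \<gamma>)"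
    by (rule orbit) (simp_all add: algebra_simps)
  have g3: "L (\<beta> + \<gamma>) * L (- \<beta> + - \<gamma>) * L (\<i> * \<beta> + \<i> * \<gamma>) * L (- \<i> * \<beta> + - \<i> * \<gamma>) = O4 (\<beta> + \<gamma>)"
    by (rule orbit) (simp_all add: algebra_simps)
  have g4: "L (\<beta> + - \<gamma>) * L (- \<beta> + \<gamma>) * L (\<i> * \<beta> + - \<i> * \<gamma>) * L (- \<i> * \<beta> + \<i> * \<gamma>) = O4 (\<beta> - \<gamma>)"
    by (rule orbit) (simp_all add: algebra_simps)
  have g5: "L (\<beta> + \<i> * \<gamma>) * L (- \<beta> + - \<i> * \<gamma>) * L (\<i> * \<beta> + - \<gamma>) * L (- \<i> * \<beta> + \<gamma>) = O4 (\<beta> + \<i> * \<gamma>)"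
    by (rule orbit) (simp_all add: algebra_simps)
  have g6: "L (\<beta> + - \<i> * \<gamma>) * L (- \<beta> + \<i> * \<gamma>) * L (\<i> * \<beta> + \<gamma>) * L (- \<i> * \<beta> + - \<gamma>) = O4 (\<beta> - \<i> * \<gamma>)"
    by (rule orbit) (simp_all add: algebra_simps)
  have r3: "O4 ((1 + \<i>) * \<beta>) * O4 ((1 + \<i>) * \<gamma>) = [:16 * C\<^sup>2, 0, 0, 0, - 4 * A, 0, 0, 0, 1:]"
  proof -
    have i4: "(1 + \<i>) ^ 4 = - 4" by (simp add: power4_eq_xxxx algebra_simps)
    have "O4 ((1 + \<i>) * \<beta>) * O4 ((1 + \<i>) * \<gamma>) =
        [:16 * ((\<beta> * \<gamma>)\<^sup>2)\<^sup>2, 0, 0, 0, 4 * (\<beta> ^ 4 + \<gamma> ^ 4), 0, 0, 0, 1:]"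
      unfolding O4_def power_mult_distrib i4 by (simp add: algebra_simps)
    then show ?thesis unfolding sum prd by simp
  qed
  have r2: "O4 (\<beta> + \<gamma>) * O4 (\<beta> - \<gamma>) = [:(A + 2 * C)\<^sup>2, 0, 0, 0, 2 * A - 12 * C, 0, 0, 0, 1:]"
    unfolding O4_def by (rule quartic_orbit_pair[OF sum prd])
  have "\<beta> ^ 4 + (\<i> * \<gamma>) ^ 4 = - A" "(\<beta> * (\<i> * \<gamma>))\<^sup>2 = - C"
    using sum prd by (simp_all add: power_mult_distrib)
  from quartic_orbit_pair[OF this]
  have r1: "O4 (\<beta> + \<i> * \<gamma>) * O4 (\<beta> - \<i> * \<gamma>) = [:(A - 2 * C)\<^sup>2, 0, 0, 0, 2 * A + 12 * C, 0, 0, 0, 1:]"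
    unfolding O4_def by simp
  have "linear_resolvent 8 (orbit_roots \<beta> \<gamma>) =
      prod_list (map (\<lambda>(i, j). L (orbit_roots \<beta> \<gamma> i + orbit_roots \<beta> \<gamma> j)) ?l)"
    unfolding linear_resolvent_def L_def[symmetric] set by (rule prod.distinct_set_conv_list[OF dist])
  also have "\<dots> =
      (L (\<beta> + - \<beta>) * L (\<i> * \<beta> + - \<i> * \<beta>) * L (\<gamma> + - \<gamma>) * L (\<i> * \<gamma> + - \<i> * \<gamma>))
    * (L (\<beta> + \<i> * \<beta>) * L (- \<beta> + - \<i> * \<beta>) * L (- \<beta> + \<i> * \<beta>) * L (\<beta> + - \<i> * \<beta>))
    * (L (\<gamma> + \<i> * \<gamma>) * L (- \<gamma> + - \<i> * \<gamma>) * L (- \<gamma> + \<i> * \<gamma>) * L (\<gamma> + - \<i> * \<gamma>))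
    * (L (\<beta> + \<gamma>) * L (- \<beta> + - \<gamma>) * L (\<i> * \<beta> + \<i> * \<gamma>) * L (- \<i> * \<beta> + - \<i> * \<gamma>))
    * (L (\<beta> + - \<gamma>) * L (- \<beta> + \<gamma>) * L (\<i> * \<beta> + - \<i> * \<gamma>) * L (- \<i> * \<beta> + \<i> * \<gamma>))
    * (L (\<beta> + \<i> * \<gamma>) * L (- \<beta> + - \<i> * \<gamma>) * L (\<i> * \<beta> + - \<gamma>) * L (- \<i> * \<beta> + \<gamma>))
    * (L (\<beta> + - \<i> * \<gamma>) * L (- \<beta> + \<i> * \<gamma>) * L (\<i> * \<beta> + \<gamma>) * L (- \<i> * \<beta> + - \<gamma>))"
    by (simp add: upt_rec orbit_roots_def ac_simps del: add_uminus_conv_diff uminus_add_conv_diff)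
  also have "\<dots> = [:0, 1:] ^ 4 * (O4 (\<beta> + \<i> * \<gamma>) * O4 (\<beta> - \<i> * \<gamma>)) * (O4 (\<beta> + \<gamma>) * O4 (\<beta> - \<gamma>))
        * (O4 ((1 + \<i>) * \<beta>) * O4 ((1 + \<i>) * \<gamma>))"
    unfolding g0 g1 g2 g3 g4 g5 g6 by (simp only: ac_simps)
  finally show ?thesis unfolding r1 r2 r3 .
qed

lemma map_poly_of_rat_mult:
  "map_poly (of_rat :: rat \<Rightarrow> 'a::field_char_0) (p * q) = map_poly of_rat p * map_poly of_rat q"
  by (rule poly_eqI) (simp add: coeff_map_poly coeff_mult of_rat_sum of_rat_mult)

lemma linear_resolvent_f_poly:
  fixes a c :: rat
  assumes roots: "map_poly of_rat (f_poly a (c\<^sup>2)) = (\<Prod>i = 1..8. [:- \<alpha> i, 1:])" and "c \<noteq> 0"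
  shows "linear_resolvent 8 \<alpha> = map_poly of_rat
    ([:0, 1:] ^ 4 * f_poly (2 * a + 12 * c) ((a - 2 * c)\<^sup>2)
       * f_poly (2 * a - 12 * c) ((a + 2 * c)\<^sup>2) * f_poly (- 4 * a) (16 * c\<^sup>2))"
proof -
  define A C :: complex where "A = of_rat a" and "C = of_rat c"
  have f: "map_poly of_rat (f_poly a (c\<^sup>2)) = [:C\<^sup>2, 0, 0, 0, A, 0, 0, 0, 1:]"
    by (simp add: f_poly_def map_poly_pCons A_def C_def of_rat_power)
  define \<beta> where "\<beta> = \<alpha> 1"
  have "poly (\<Prod>i = 1..8. [:- \<alpha> i, 1:]) \<beta> = 0"
    unfolding poly_prod \<beta>_def by (rule prod_zero) (auto intro!: bexI[of _ 1])
  then have \<beta>: "\<beta> ^ 8 + A * \<beta> ^ 4 + C\<^sup>2 = 0"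
    unfolding roots[symmetric] f by (simp add: algebra_simps eval_nat_numeral)
  have "\<beta> \<noteq> 0"
    using \<beta> \<open>c \<noteq> 0\<close> by (auto simp: C_def)
  \<comment> \<open>chosen so that \<open>\<gamma>\<^sup>4\<close> is the other root \<open>c\<^sup>2 / \<beta>\<^sup>4\<close> of \<open>y\<^sup>2 + a y + c\<^sup>2\<close>, with \<open>(\<beta> \<gamma>)\<^sup>2 = c\<close>; the sign \<open>- c\<close> would exchange the roles of \<open>\<beta> \<plusminus> \<gamma>\<close> and \<open>\<beta> \<plusminus> \<i> \<gamma>\<close>\<close>
  define \<gamma> where "\<gamma> = csqrt C / \<beta>"
  have \<beta>\<gamma>: "\<beta> * \<gamma> = csqrt C" using \<open>\<beta> \<noteq> 0\<close> by (simp add: \<gamma>_def)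
  then have prd: "(\<beta> * \<gamma>)\<^sup>2 = C" by simp
  have "\<beta> ^ 4 * (\<beta> ^ 4 + \<gamma> ^ 4 + A) = \<beta> ^ 8 + A * \<beta> ^ 4 + ((\<beta> * \<gamma>)\<^sup>2)\<^sup>2" by algebra
  also have "\<dots> = 0" unfolding prd by (rule \<beta>)
  finally have sum: "\<beta> ^ 4 + \<gamma> ^ 4 = - A" using \<open>\<beta> \<noteq> 0\<close> by (simp add: add_eq_0_iff2)
  have "linear_resolvent 8 \<alpha> = linear_resolvent 8 (orbit_roots \<beta> \<gamma>)"
    by (rule linear_resolvent_cong) (simp only: roots[symmetric] f prod_orbit_roots[OF sum prd])
  also note linear_resolvent_orbit_roots[OF sum prd]
  finally show ?thesis
    by (simp only: map_poly_of_rat_mult power4_eq_xxxx)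
       (simp add: f_poly_def map_poly_pCons A_def C_def of_rat_power of_rat_add of_rat_diff of_rat_mult of_rat_minus)
qed

section \<open>The proposition\<close>

theorem proposition3p3:
  fixes a b :: rat and \<alpha> :: "nat \<Rightarrow> complex"
  assumes "is_square b"
    and "irreducible (f_poly a b)"
    and roots: "map_poly of_rat (f_poly a b) = (\<Prod>i = 1..8. [:- \<alpha> i, 1:])"
  shows
    "(irreducible (subst_sq (R1 a b)) \<longleftrightarrow> \<not> is_square (2 * b + a * rat_sqrt b))
     \<and> (is_square (2 * b + a * rat_sqrt b) \<longrightarrow>
          subst_sq (R1 a b) =
            [:a + 6 * rat_sqrt b + 4 * rat_sqrt (2 * b + a * rat_sqrt b), 0, 0, 0, 1:] *
            [:a + 6 * rat_sqrt b - 4 * rat_sqrt (2 * b + a * rat_sqrt b), 0, 0, 0, 1:])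

     \<and> (irreducible (subst_sq (R2 a b)) \<longleftrightarrow>
          \<not> is_square (rat_sqrt b) \<and> \<not> is_square (2 * b - a * rat_sqrt b))
     \<and> (is_square (rat_sqrt b) \<longrightarrow>
          subst_sq (R2 a b) =
            [:a + 2 * rat_sqrt b, 0, 4 * rat_sqrt (rat_sqrt b), 0, 1:] *
            [:a + 2 * rat_sqrt b, 0, - 4 * rat_sqrt (rat_sqrt b), 0, 1:])
     \<and> (is_square (2 * b - a * rat_sqrt b) \<longrightarrow>
          subst_sq (R2 a b) =
            [:a - 6 * rat_sqrt b + 4 * rat_sqrt (2 * b - a * rat_sqrt b), 0, 0, 0, 1:] *
            [:a - 6 * rat_sqrt b - 4 * rat_sqrt (2 * b - a * rat_sqrt b), 0, 0, 0, 1:])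

     \<and> (irreducible (subst_sq (R3 a b)) \<longleftrightarrow>
          \<not> is_square (a - 2 * rat_sqrt b) \<and> \<not> is_square (a + 2 * rat_sqrt b))
     \<and> (is_square (a - 2 * rat_sqrt b) \<longrightarrow>
          subst_sq (R3 a b) =
            [:- 4 * rat_sqrt b, 0, 2 * rat_sqrt (a - 2 * rat_sqrt b), 0, 1:] *
            [:- 4 * rat_sqrt b, 0, - 2 * rat_sqrt (a - 2 * rat_sqrt b), 0, 1:])
     \<and> (is_square (a + 2 * rat_sqrt b) \<longrightarrow>
          subst_sq (R3 a b) =
            [:4 * rat_sqrt b, 0, 2 * rat_sqrt (a + 2 * rat_sqrt b), 0, 1:] *
            [:4 * rat_sqrt b, 0, - 2 * rat_sqrt (a + 2 * rat_sqrt b), 0, 1:])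

     \<and> (\<exists>R :: rat poly. map_poly of_rat R = linear_resolvent 8 \<alpha> \<and>
          (\<forall>Q \<in> {R1 a b, R2 a b, R3 a b}. \<forall>p. irreducible p \<and> p dvd subst_sq Q \<longrightarrow>
             multiplicity p R = 1))"
proof -
  define c where "c = rat_sqrt b"
  have c: "0 \<le> c" and b: "b = c\<^sup>2"
    using rat_sqrt_nonneg_power2[OF \<open>is_square b\<close>] by (simp_all add: c_def)
  note f = irreducible_f_polyD[OF \<open>irreducible (f_poly a b)\<close>[unfolded b]]
  have "c \<noteq> 0" using f(1) by auto
  with c have "c > 0" by simp
  have not_sq_0: "x \<noteq> 0" if "\<not> is_square x" for x :: rat using that by auto
  have nz: "a - 2 * c \<noteq> 0" "a + 2 * c \<noteq> 0"
    using f(2,3)[THEN not_sq_0] by auto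

  define r1 where "r1 = f_poly (2 * a + 12 * c) ((a - 2 * c)\<^sup>2)"
  define r2 where "r2 = f_poly (2 * a - 12 * c) ((a + 2 * c)\<^sup>2)"
  define r3 where "r3 = f_poly (- 4 * a) (16 * c\<^sup>2)"
  have subst: "subst_sq (R1 a b) = r1" "subst_sq (R2 a b) = r2" "subst_sq (R3 a b) = r3"
    unfolding R1_def R2_def R3_def c_def[symmetric] subst_sq_even_quartic r1_def r2_def r3_def
    using b by simp_all

  have fac1: "r1 = [:a + 6 * c + 4 * rat_sqrt (2 * b + a * c), 0, 0, 0, 1:] *
      [:a + 6 * c - 4 * rat_sqrt (2 * b + a * c), 0, 0, 0, 1:]" if "is_square (2 * b + a * c)"
    unfolding r1_def
    by (rule f_poly_binomial_factors)
       (use rat_sqrt_nonneg_power2(2)[OF that] b in \<open>simp_all add: power_mult_distrib power2_eq_square algebra_simps\<close>)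
  have fac2a: "r2 = [:a + 2 * c, 0, 4 * rat_sqrt c, 0, 1:] * [:a + 2 * c, 0, - 4 * rat_sqrt c, 0, 1:]"
    if "is_square c"
    using f_poly_conjugate_factors[of "4 * rat_sqrt c" "a + 2 * c" "2 * a - 12 * c"] rat_sqrt_nonneg_power2(2)[OF that]
    by (simp add: r2_def power_mult_distrib)
  have fac2b: "r2 = [:a - 6 * c + 4 * rat_sqrt (2 * b - a * c), 0, 0, 0, 1:] *
      [:a - 6 * c - 4 * rat_sqrt (2 * b - a * c), 0, 0, 0, 1:]" if "is_square (2 * b - a * c)"
    unfolding r2_def
    by (rule f_poly_binomial_factors)
       (use rat_sqrt_nonneg_power2(2)[OF that] b in \<open>simp_all add: power_mult_distrib power2_eq_square algebra_simps\<close>)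
  have fac3a: "r3 = [:- 4 * c, 0, 2 * rat_sqrt (a - 2 * c), 0, 1:] * [:- 4 * c, 0, - 2 * rat_sqrt (a - 2 * c), 0, 1:]"
    if "is_square (a - 2 * c)"
    using f_poly_conjugate_factors[of "2 * rat_sqrt (a - 2 * c)" "- 4 * c" "- 4 * a"] rat_sqrt_nonneg_power2(2)[OF that]
    by (simp add: r3_def power_mult_distrib)
  have fac3b: "r3 = [:4 * c, 0, 2 * rat_sqrt (a + 2 * c), 0, 1:] * [:4 * c, 0, - 2 * rat_sqrt (a + 2 * c), 0, 1:]"
    if "is_square (a + 2 * c)"
    using f_poly_conjugate_factors[of "2 * rat_sqrt (a + 2 * c)" "4 * c" "- 4 * a"] rat_sqrt_nonneg_power2(2)[OF that]
    by (simp add: r3_def power_mult_distrib)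

  have "\<not> is_square (- c)" using \<open>c > 0\<close> is_square_rat_nonneg[of "- c"] by auto
  then have "irreducible r1" if "\<not> is_square (2 * b + a * c)"
    unfolding r1_def using that b f by (intro irreducible_resolvent_factor) simp_all
  moreover have "\<not> irreducible r1" if "is_square (2 * b + a * c)"
    unfolding fac1[OF that] by (rule not_irreducible_mult) simp_all
  ultimately have irr1: "irreducible r1 \<longleftrightarrow> \<not> is_square (2 * b + a * c)"
    by blast
  have "irreducible r2" if "\<not> is_square c" "\<not> is_square (2 * b - a * c)"
    using irreducible_resolvent_factor[of a "- c"] that b f by (simp add: r2_def)
  moreover have "\<not> irreducible r2" if "is_square c"
    unfolding fac2a[OF that] by (rule not_irreducible_mult) simp_all
  moreover have "\<not> irreducible r2" if "is_square (2 * b - a * c)"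
    unfolding fac2b[OF that] by (rule not_irreducible_mult) simp_all
  ultimately have irr2: "irreducible r2 \<longleftrightarrow> \<not> is_square c \<and> \<not> is_square (2 * b - a * c)"
    by blast
  have "irreducible r3" if "\<not> is_square (a - 2 * c)" "\<not> is_square (a + 2 * c)"
    using irreducible_resolvent_factor_R3[OF \<open>c > 0\<close> f(1,2) that] by (simp add: r3_def power_mult_distrib)
  moreover have "\<not> irreducible r3" if "is_square (a - 2 * c)"
    unfolding fac3a[OF that] by (rule not_irreducible_mult) simp_all
  moreover have "\<not> irreducible r3" if "is_square (a + 2 * c)"
    unfolding fac3b[OF that] by (rule not_irreducible_mult) simp_all
  ultimately have irr3: "irreducible r3 \<longleftrightarrow> \<not> is_square (a - 2 * c) \<and> \<not> is_square (a + 2 * c)"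
    by blast

  define R where "R = [:0, 1:] ^ 4 * r1 * r2 * r3"
  have R: "map_poly of_rat R = linear_resolvent 8 \<alpha>"
    using linear_resolvent_f_poly[OF roots[unfolded b] \<open>c \<noteq> 0\<close>] unfolding R_def r1_def r2_def r3_def by simp

  have cop12: "\<not> (p dvd r1 \<and> p dvd r2)" if "\<not> is_unit p" for p
    using coprime_R1_R2[OF _ _ \<open>c \<noteq> 0\<close>] that unfolding r1_def r2_def by blast
  have cop3: "\<not> (p dvd f_poly (2 * a + 12 * e) ((a - 2 * e)\<^sup>2) \<and> p dvd r3)"
    if "\<not> is_unit p" "e \<in> {c, - c}" for p e
  proof
    assume "p dvd f_poly (2 * a + 12 * e) ((a - 2 * e)\<^sup>2) \<and> p dvd r3"
    moreover have "e \<noteq> 0" "a + 2 * e \<noteq> 0" using that(2) \<open>c \<noteq> 0\<close> nz by auto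
    moreover have "r3 = f_poly (- 4 * a) (16 * e\<^sup>2)" using that(2) by (auto simp: r3_def)
    ultimately show False using coprime_R1_R3 that(1) by metis
  qed
  have cop13: "\<not> (p dvd r1 \<and> p dvd r3)" if "\<not> is_unit p" for p
    using cop3[OF that, of c] by (simp add: r1_def)
  have cop23: "\<not> (p dvd r2 \<and> p dvd r3)" if "\<not> is_unit p" for p
    using cop3[OF that, of "- c"] by (simp add: r2_def)

  have sep: "(2 * a + 12 * e)\<^sup>2 - 4 * (a - 2 * e)\<^sup>2 \<noteq> 0" if "e \<in> {c, - c}" for e
  proof -
    have "(2 * a + 12 * e)\<^sup>2 - 4 * (a - 2 * e)\<^sup>2 = 64 * e * (a + 2 * e)" by algebra
    then show ?thesis using that \<open>c \<noteq> 0\<close> nz by auto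
  qed
  have "(- 4 * a)\<^sup>2 - 4 * (16 * c\<^sup>2) = 16 * (a\<^sup>2 - 4 * c\<^sup>2)" by algebra
  then have sep3: "(- 4 * a)\<^sup>2 - 4 * (16 * c\<^sup>2) \<noteq> 0"
    using not_sq_0[OF f(1)] by simp
  have mult: "multiplicity p R = 1" if p: "irreducible p" and dvd: "p dvd r1 \<or> p dvd r2 \<or> p dvd r3" for p
  proof -
    have prime: "prime_elem p" using p by (rule field_poly_irreducible_imp_prime)
    then have nu: "\<not> is_unit p" by (simp add: prime_elem_def)
    have X: "\<not> p dvd [:0, 1:] ^ 4"
      using dvd prime_factor_f_poly_not_dvd_X_power[OF prime] nz \<open>c \<noteq> 0\<close> unfolding r1_def r2_def r3_def by auto
    note prod = multiplicity_eq_1_last_factor[OF prime]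
    from dvd consider "p dvd r1" | "p dvd r2" | "p dvd r3" by blast
    then show ?thesis
    proof cases
      case 1
      then have "multiplicity p r1 = 1"
        unfolding r1_def using multiplicity_f_poly_eq_1[OF prime] sep[of c] nz by simp
      moreover have "R = [:0, 1:] ^ 4 * r2 * r3 * r1" unfolding R_def by (simp only: ac_simps)
      ultimately show ?thesis
        using prod[of "[:0, 1:] ^ 4" r2 r3 r1] X 1 cop12[OF nu] cop13[OF nu]
        by (simp add: r1_def r2_def r3_def)
    next
      case 2
      then have "multiplicity p r2 = 1"
        unfolding r2_def using multiplicity_f_poly_eq_1[OF prime] sep[of "- c"] nz by simp
      moreover have "R = [:0, 1:] ^ 4 * r1 * r3 * r2" unfolding R_def by (simp only: ac_simps)
      ultimately show ?thesis
        using prod[of "[:0, 1:] ^ 4" r1 r3 r2] X 2 cop12[OF nu] cop23[OF nu]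
        by (simp add: r1_def r2_def r3_def)
    next
      case 3
      then have "multiplicity p r3 = 1"
        unfolding r3_def using multiplicity_f_poly_eq_1[OF prime] sep3 \<open>c \<noteq> 0\<close> by simp
      then show ?thesis
        using prod[of "[:0, 1:] ^ 4" r1 r2 r3] X 3 cop13[OF nu] cop23[OF nu]
        by (simp add: R_def r1_def r2_def r3_def)
    qed
  qed
  show ?thesis
    unfolding c_def[symmetric] subst
    using irr1 irr2 irr3 fac1 fac2a fac2b fac3a fac3b R mult by (auto simp: subst)
qed

end
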